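(* Let $G=(V,E)$ be a finite, connected, simple, walk-regular graph with $|V|\ge 3$, with unit resistance across each edge. Let $(a,b)\in E$ be an edge which is not a cut-edge (that is, deleting it leaves the graph connected), and let $G'$ be the graph formed from $G$ by deleting the edge $(a,b)$. Let $R_{ab}$ denote the effective resistance between $a$ and $b$ in $G$, let $E_aT_b$ denote the expected hitting time of $b$ for simple random walk on $G$ started at $a$, and let $E_aT_b^{G'}$ denote the expected hitting time of $b$ for simple random walk on $G'$ started at $a$. Then, on deleting the edge $(a,b)$, the expected hitting time increases from $$E_aT_b=|E|\,R_{ab}$$ to $$E_aT_b^{G'}=\frac{(|E|-1)R_{ab}}{1-R_{ab}}=\frac{E_aT_b-R_{ab}}{1-R_{ab}}.$$
   Context: Simple random walk on a graph is the Markov chain $X_j$ on the vertex set with $P(X_{j+1}=z\mid X_j=y)=1/\deg(y)$ if $y$ and $z$ are adjacent, and $0$ otherwise. The hitting time of a vertex $b$ is $T_b=\inf\{j\ge 0: X_j=b\}$, and $E_a$ denotes expectation for the walk started at $X_0=a$. The graph is viewed as an electric network in which every edge is a resistor of unit resistance. The effective resistance $R_{ab}$ between distinct vertices $a,b$ is the voltage difference between $a$ and $b$ when a unit current enters the network at $a$ and leaves at $b$. A graph is walk-regular if, for every $k\ge 2$, the number of closed walks of length $k$ (repeated vertices and edges allowed) starting and ending at a vertex $x$ is the same for every choice of the vertex $x$. *)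

theory Defs
  imports "HOL-Probability.Probability"
begin

text \<open>A graph is given by its vertex set \<open>V\<close> and its set \<open>E\<close> of edges, an edge being a
  two-element set of vertices; thus \<open>card E\<close> counts unoriented edges.\<close>

definition finite_simple_graph :: "'a set \<Rightarrow> 'a set set \<Rightarrow> bool" where
  "finite_simple_graph V E \<longleftrightarrow> finite V \<and> (\<forall>e\<in>E. e \<subseteq> V \<and> card e = 2)"

definition degree :: "'a set set \<Rightarrow> 'a \<Rightarrow> nat" where
  "degree E x = card {y. {x, y} \<in> E}"

text \<open>A walk of length \<open>k\<close> is recorded by its \<open>k + 1\<close> vertices.\<close>

definition walks :: "'a set \<Rightarrow> 'a set set \<Rightarrow> nat \<Rightarrow> 'a \<Rightarrow> 'a \<Rightarrow> 'a list set" where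
  "walks V E k x y =
     {p. length p = Suc k \<and> set p \<subseteq> V \<and> hd p = x \<and> last p = y \<and>
         (\<forall>i<k. {p ! i, p ! Suc i} \<in> E)}"

definition connected_graph :: "'a set \<Rightarrow> 'a set set \<Rightarrow> bool" where
  "connected_graph V E \<longleftrightarrow> V \<noteq> {} \<and> (\<forall>x\<in>V. \<forall>y\<in>V. \<exists>k. walks V E k x y \<noteq> {})"

definition walk_regular :: "'a set \<Rightarrow> 'a set set \<Rightarrow> bool" where
  "walk_regular V E \<longleftrightarrow>
     (\<forall>k\<ge>2. \<forall>x\<in>V. \<forall>y\<in>V. card (walks V E k x x) = card (walks V E k y y))"

text \<open>By Ohm's law, the current from \<open>x\<close> to a neighbour \<open>y\<close> through the unit resistor is
  \<open>v x - v y\<close>. Kirchhoff's current law then says that the net current out of \<open>x\<close> into the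
  network equals the external current supplied at \<open>x\<close>: \<open>1\<close> at \<open>a\<close>, \<open>-1\<close> at \<open>b\<close>, and \<open>0\<close>
  elsewhere.\<close>

definition unit_current_voltage ::
    "'a set \<Rightarrow> 'a set set \<Rightarrow> 'a \<Rightarrow> 'a \<Rightarrow> ('a \<Rightarrow> real) \<Rightarrow> bool" where
  "unit_current_voltage V E a b v \<longleftrightarrow>
     (\<forall>x\<in>V. (\<Sum>y | {x, y} \<in> E. v x - v y) = (if x = a then 1 else if x = b then - 1 else 0))"

text \<open>For distinct vertices \<open>a\<close>, \<open>b\<close> of a finite connected graph the voltage exists and is
  unique on \<open>V\<close> up to an additive constant, so the description below is proper.\<close>

definition effective_resistance :: "'a set \<Rightarrow> 'a set set \<Rightarrow> 'a \<Rightarrow> 'a \<Rightarrow> real" where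
  "effective_resistance V E a b =
     (THE r. \<exists>v. unit_current_voltage V E a b v \<and> r = v a - v b)"

definition transition_prob :: "'a set set \<Rightarrow> 'a \<Rightarrow> 'a \<Rightarrow> real" where
  "transition_prob E y z = (if {y, z} \<in> E then 1 / real (degree E y) else 0)"

text \<open>\<open>X\<close> is a simple random walk on the graph, started at \<open>a\<close> and realized on the probability
  space \<open>M\<close>. The Markov property is expressed by conditioning on every history \<open>p 0, \<dots>, p j\<close> of
  positive probability.\<close>

definition simple_random_walk ::
    "'a set \<Rightarrow> 'a set set \<Rightarrow> 'a \<Rightarrow> 'm measure \<Rightarrow> (nat \<Rightarrow> 'm \<Rightarrow> 'a) \<Rightarrow> bool" where
  "simple_random_walk V E a M X \<longleftrightarrow>
     prob_space M \<and>
     (\<forall>j. X j \<in> measurable M (count_space V)) \<and>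
     \<P>(\<omega> in M. X 0 \<omega> = a) = 1 \<and>
     (\<forall>j p z. z \<in> V \<longrightarrow> \<P>(\<omega> in M. \<forall>i\<le>j. X i \<omega> = p i) > 0 \<longrightarrow>
        \<P>(\<omega> in M. X (Suc j) \<omega> = z \<bar> \<forall>i\<le>j. X i \<omega> = p i) = transition_prob E (p j) z)"

text \<open>The infimum over the empty set is \<open>\<infinity>\<close>.\<close>

definition hitting_time :: "(nat \<Rightarrow> 'm \<Rightarrow> 'a) \<Rightarrow> 'a \<Rightarrow> 'm \<Rightarrow> enat" where
  "hitting_time X b \<omega> = Inf {enat j | j. X j \<omega> = b}"

definition expected_hitting_time :: "'m measure \<Rightarrow> (nat \<Rightarrow> 'm \<Rightarrow> 'a) \<Rightarrow> 'a \<Rightarrow> ennreal" where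
  "expected_hitting_time M X b = (\<integral>\<^sup>+\<omega>. ennreal_of_enat (hitting_time X b \<omega>) \<partial>M)"

end

theory Submission
  imports Defs
begin

text \<open>Let \<open>L\<close> be the graph Laplacian and \<open>v\<close> a voltage, \<open>L v = \<delta>\<^sub>a - \<delta>\<^sub>b\<close>. The function
  \<open>h x = E\<^sub>x T\<^sub>b\<close> satisfies \<open>L h = deg - 2 |E| \<delta>\<^sub>b\<close> and \<open>h b = 0\<close>, so self-adjointness of \<open>L\<close> gives
  \<open>E\<^sub>a T\<^sub>b = \<Sum>\<^sub>x deg x (v x - v b)\<close> on every connected graph. On a walk-regular graph every
  polynomial in \<open>L\<close> has constant diagonal; as \<open>v\<close> may be chosen of the form
  \<open>p(L) (\<delta>\<^sub>a - \<delta>\<^sub>b)\<close>, it satisfies \<open>v a + v b = 0\<close> and \<open>\<Sum> v = 0\<close>, whence \<open>E\<^sub>a T\<^sub>b = |E| R\<close>. Deleting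
  the edge replaces \<open>L v\<close> by \<open>(1 - R) (\<delta>\<^sub>a - \<delta>\<^sub>b)\<close>, so \<open>v / (1 - R)\<close> is a voltage for the new graph,
  and the degrees drop by one at \<open>a\<close> and \<open>b\<close> only.\<close>

subsection \<open>The Laplacian of a finite graph\<close>

definition laplacian :: "'a set set \<Rightarrow> ('a \<Rightarrow> real) \<Rightarrow> 'a \<Rightarrow> real" where
  "laplacian E f x = (\<Sum>y | {x, y} \<in> E. f x - f y)"

definition adjacency :: "'a set set \<Rightarrow> ('a \<Rightarrow> real) \<Rightarrow> 'a \<Rightarrow> real" where
  "adjacency E f x = (\<Sum>y | {x, y} \<in> E. f y)"

lemma laplacian_sum:
  "laplacian E (\<lambda>x. \<Sum>k\<in>K. c k * f k x) = (\<lambda>x. \<Sum>k\<in>K. c k * laplacian E (f k) x)"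
proof
  fix x
  have "laplacian E (\<lambda>x. \<Sum>k\<in>K. c k * f k x) x
      = (\<Sum>y | {x, y} \<in> E. \<Sum>k\<in>K. c k * (f k x - f k y))"
    unfolding laplacian_def by (simp add: sum_subtractf right_diff_distrib)
  also have "\<dots> = (\<Sum>k\<in>K. \<Sum>y | {x, y} \<in> E. c k * (f k x - f k y))"
    by (rule sum.swap)
  finally show "laplacian E (\<lambda>x. \<Sum>k\<in>K. c k * f k x) x = (\<Sum>k\<in>K. c k * laplacian E (f k) x)"
    unfolding laplacian_def by (simp add: sum_distrib_left)
qed

lemma laplacian_diff:
  "laplacian E (\<lambda>x. f x - g x) = (\<lambda>x. laplacian E f x - laplacian E g x)"
  unfolding laplacian_def sum_subtractf[symmetric] by (intro ext sum.cong) auto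

lemma laplacian_scale: "laplacian E (\<lambda>x. c * f x) = (\<lambda>x. c * laplacian E f x)"
  unfolding laplacian_def by (simp add: sum_distrib_left right_diff_distrib)

lemma laplacian_shift: "laplacian E (\<lambda>x. f x - c) x = laplacian E f x"
  unfolding laplacian_def by simp

lemma laplacian_power_diff:
  "(laplacian E ^^ k) (\<lambda>x. f x - g x) = (\<lambda>x. (laplacian E ^^ k) f x - (laplacian E ^^ k) g x)"
  by (induction k) (simp_all add: laplacian_diff)

lemma laplacian_power_scale:
  "(laplacian E ^^ k) (\<lambda>x. c * f x) = (\<lambda>x. c * (laplacian E ^^ k) f x)"
  by (induction k) (simp_all add: laplacian_scale)

text \<open>Gaussian elimination, one point of \<open>V\<close> per induction step: unless all
  functions vanish at the new point, one of them serves as a pivot and leaves the family.\<close>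

lemma linear_dependence:
  fixes f :: "'i \<Rightarrow> 'a \<Rightarrow> real"
  assumes "finite V" "finite I" "card V < card I"
  shows "\<exists>c. (\<exists>i\<in>I. c i \<noteq> 0) \<and> (\<forall>x\<in>V. (\<Sum>i\<in>I. c i * f i x) = 0)"
  using assms
proof (induction V arbitrary: I f rule: finite_induct)
  case empty
  then show ?case by (intro exI[of _ "\<lambda>_. 1"]) (auto simp: card_gt_0_iff)
next
  case (insert x V)
  show ?case
  proof (cases "\<forall>i\<in>I. f i x = 0")
    case True
    from insert.prems insert.hyps have "card V < card I" by simp
    from insert.IH[OF insert.prems(1) this, of f] True show ?thesis by auto
  next
    case False
    then obtain m where m: "m \<in> I" "f m x \<noteq> 0" by auto
    define J where "J = I - {m}"
    have J: "finite J" "card V < card J" "I = insert m J" "m \<notin> J"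
      using insert.prems insert.hyps m by (auto simp: J_def)
    \<comment> \<open>Subtracting a multiple of the pivot \<open>f m\<close> makes every other
      function vanish at \<open>x\<close>, so a relation on \<open>V\<close> suffices.\<close>
    obtain c where c: "\<exists>i\<in>J. c i \<noteq> 0"
      "\<And>y. y \<in> V \<Longrightarrow> (\<Sum>i\<in>J. c i * (f i y - f i x / f m x * f m y)) = 0"
      using insert.IH[OF J(1,2), of "\<lambda>i y. f i y - f i x / f m x * f m y"] by blast
    define s where "s = (\<Sum>i\<in>J. c i * f i x)"
    \<comment> \<open>The pivot collects what was subtracted from the others, which turns the
      relation for the corrected functions into one for \<open>f\<close>.\<close>
    define c' where "c' = c(m := - s / f m x)"
    have sum_c': "(\<Sum>i\<in>I. c' i * f i y) = (\<Sum>i\<in>J. c i * f i y) - s / f m x * f m y" for y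
    proof -
      have "(\<Sum>i\<in>J. c' i * f i y) = (\<Sum>i\<in>J. c i * f i y)"
        using J(4) by (intro sum.cong) (auto simp: c'_def)
      then show ?thesis using J by (simp add: c'_def)
    qed
    have "(\<Sum>i\<in>J. c i * (f i y - f i x / f m x * f m y))
        = (\<Sum>i\<in>J. c i * f i y) - s / f m x * f m y" for y
      by (simp add: s_def right_diff_distrib sum_subtractf sum_divide_distrib sum_distrib_right
          mult.assoc)
    then have "(\<Sum>i\<in>I. c' i * f i y) = 0" if "y \<in> insert x V" for y
      using that c(2)[of y] m(2) sum_c'[of y] by (auto simp: s_def)
    moreover have "\<exists>i\<in>I. c' i \<noteq> 0" using c(1) J by (auto simp: c'_def)
    ultimately show ?thesis by blast
  qed
qed

section \<open>Energy form, degree sum and walk counts\<close>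

locale finite_graph =
  fixes V :: "'a set" and E :: "'a set set"
  assumes fsg: "finite_simple_graph V E"
begin

lemma finite_V: "finite V" using fsg by (simp add: finite_simple_graph_def)

lemma edge_in_V: "{x, y} \<in> E \<Longrightarrow> x \<in> V \<and> y \<in> V \<and> x \<noteq> y"
  using fsg unfolding finite_simple_graph_def
  by (metis card_2_iff doubleton_eq_iff insert_subset)

lemma sum_times_indicator: "c \<in> V \<Longrightarrow> (\<Sum>x\<in>V. g x * indicator {c} x) = (g c :: real)"
  using finite_V by (subst sum.remove[of _ c]) (auto intro: sum.neutral)

lemma sum_indicator_times: "c \<in> V \<Longrightarrow> (\<Sum>x\<in>V. indicator {c} x * g x) = (g c :: real)"
  using finite_V by (subst sum.remove[of _ c]) (auto intro: sum.neutral)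

lemma sum_times_dipole:
  assumes "a \<in> V" "b \<in> V"
  shows "(\<Sum>x\<in>V. g x * (indicator {a} x - indicator {b} x)) = g a - (g b :: real)"
  using assms by (simp add: right_diff_distrib sum_subtractf sum_times_indicator)

lemma finite_E: "finite E"
proof -
  have "E \<subseteq> Pow V" using fsg by (auto simp: finite_simple_graph_def)
  then show ?thesis using finite_V by (meson finite_Pow_iff finite_subset)
qed

lemma nbrs_subset: "{y. {x, y} \<in> E} \<subseteq> V" using edge_in_V by auto

lemma finite_nbrs: "finite {y. {x, y} \<in> E}"
  using finite_subset[OF nbrs_subset finite_V] .

lemma sum_nbrs: "(\<Sum>y | {x, y} \<in> E. g y) = (\<Sum>y\<in>V. if {x, y} \<in> E then g y else (0::real))"
proof -
  have "(\<Sum>y\<in>V. if {x, y} \<in> E then g y else 0) = (\<Sum>y\<in>V \<inter> {y. {x, y} \<in> E}. g y)"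
    using sum.inter_restrict[OF finite_V, of g "{y. {x, y} \<in> E}"] by simp
  then show ?thesis using nbrs_subset[of x] by (simp add: Int_absorb1)
qed

lemma laplacian_eq: "laplacian E f x = real (degree E x) * f x - adjacency E f x"
  by (simp add: laplacian_def adjacency_def degree_def sum_subtractf)

text \<open>Summation by parts: the double sum runs over oriented edges, and averaging it with its
  copy under exchange of \<open>x\<close> and \<open>y\<close> replaces \<open>g x\<close> by
  \<open>g x - g y\<close>, with a factor 1/2. Symmetry, nonnegative energy and zero total of the
  Laplacian are read off from this form.\<close>

lemma dirichlet_form:
  "(\<Sum>x\<in>V. g x * laplacian E f x)
    = (\<Sum>x\<in>V. \<Sum>y\<in>V. if {x, y} \<in> E then (f x - f y) * (g x - g y) else 0) / 2"
proof -
  define F where "F x y = (if {x, y} \<in> E then g x * (f x - f y) else 0)" for x y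
  have 1: "(\<Sum>x\<in>V. g x * laplacian E f x) = (\<Sum>x\<in>V. \<Sum>y\<in>V. F x y)"
    unfolding laplacian_def sum_nbrs sum_distrib_left F_def
    by (intro sum.cong) auto
  have 2: "\<dots> = (\<Sum>x\<in>V. \<Sum>y\<in>V. F y x)" by (rule sum.swap)
  have "(\<Sum>x\<in>V. \<Sum>y\<in>V. F x y) + (\<Sum>x\<in>V. \<Sum>y\<in>V. F y x)
      = (\<Sum>x\<in>V. \<Sum>y\<in>V. if {x, y} \<in> E then (f x - f y) * (g x - g y) else 0)"
    unfolding sum.distrib[symmetric] F_def
    by (intro sum.cong) (auto simp: insert_commute algebra_simps)
  with 1 2 show ?thesis by simp
qed

lemma laplacian_self_adjoint:
  "(\<Sum>x\<in>V. g x * laplacian E f x) = (\<Sum>x\<in>V. f x * laplacian E g x)"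
  unfolding dirichlet_form by (simp add: mult.commute cong: if_cong)

lemma laplacian_power_self_adjoint:
  "(\<Sum>x\<in>V. g x * (laplacian E ^^ k) f x) = (\<Sum>x\<in>V. f x * (laplacian E ^^ k) g x)"
proof (induction k arbitrary: f)
  case 0
  then show ?case by (simp add: mult.commute)
next
  case (Suc k)
  have "(\<Sum>x\<in>V. g x * (laplacian E ^^ Suc k) f x)
      = (\<Sum>x\<in>V. g x * (laplacian E ^^ k) (laplacian E f) x)"
    by (simp only: funpow_Suc_right o_apply)
  also have "\<dots> = (\<Sum>x\<in>V. (laplacian E ^^ k) g x * laplacian E f x)"
    unfolding Suc.IH by (simp add: mult.commute)
  also have "\<dots> = (\<Sum>x\<in>V. f x * (laplacian E ^^ Suc k) g x)"
    by (simp add: laplacian_self_adjoint)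
  finally show ?case .
qed

lemma laplacian_energy_nonneg: "0 \<le> (\<Sum>x\<in>V. f x * laplacian E f x)"
  unfolding dirichlet_form by (auto intro!: sum_nonneg)

lemma sum_laplacian: "(\<Sum>x\<in>V. laplacian E f x) = 0"
  using dirichlet_form[of "\<lambda>_. 1" f] by (simp cong: if_cong)

lemma handshake: "(\<Sum>x\<in>V. degree E x) = 2 * card E"
proof -
  have "degree E x = card {e\<in>E. x \<in> e}" if "x \<in> V" for x
  proof -
    have "\<exists>y. e = {x, y}" if "e \<in> E" "x \<in> e" for e
    proof -
      have "card e = 2" using fsg that by (auto simp: finite_simple_graph_def)
      with that show ?thesis by (auto simp: card_2_iff)
    qed
    then have "bij_betw (\<lambda>y. {x, y}) {y. {x, y} \<in> E} {e\<in>E. x \<in> e}"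
      unfolding bij_betw_def by (fastforce simp: inj_on_def doubleton_eq_iff)
    then show ?thesis unfolding degree_def by (rule bij_betw_same_card)
  qed
  then have "(\<Sum>x\<in>V. degree E x) = (\<Sum>x\<in>V. card {e\<in>E. x \<in> e})" by simp
  also have "\<dots> = 2 * card E"
  proof (rule sum_multicount[OF finite_V finite_E], intro ballI)
    fix e assume "e \<in> E"
    then have "{x \<in> V. x \<in> e} = e" "card e = 2"
      using fsg by (auto simp: finite_simple_graph_def)
    then show "card {x \<in> V. x \<in> e} = 2" by simp
  qed
  finally show ?thesis .
qed

lemma real_handshake: "(\<Sum>x\<in>V. real (degree E x)) = 2 * real (card E)"
  using handshake by (metis of_nat_mult of_nat_numeral of_nat_sum)

text \<open>Allows identities between operators to be proved as equalities of functions on the whole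
  type, so that further powers can be applied to them.\<close>

lemma adjacency_power_outside:
  assumes "x \<in> V" "z \<notin> V"
  shows "(adjacency E ^^ k) (indicator {x}) z = 0"
proof (cases k)
  case 0
  then show ?thesis using assms by (auto simp: indicator_def)
next
  case (Suc n)
  have "{y. {z, y} \<in> E} = {}" using edge_in_V assms(2) by auto
  then show ?thesis using Suc by (simp add: adjacency_def)
qed

lemma walks_0: "x \<in> V \<Longrightarrow> walks V E 0 x y = (if x = y then {[x]} else {})"
  by (auto simp: walks_def length_Suc_conv)

lemma walks_Suc:
  assumes "x \<in> V"
  shows "walks V E (Suc k) x y = (\<Union>z\<in>{z. {x, z} \<in> E}. (#) x ` walks V E k z y)"
proof (intro set_eqI iffI)
  fix p assume p: "p \<in> walks V E (Suc k) x y"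
  then obtain q where q: "p = x # q" "length q = Suc k"
    by (cases p) (auto simp: walks_def)
  have "\<forall>i<Suc k. {p ! i, p ! Suc i} \<in> E" using p by (simp add: walks_def)
  then have e: "{x, q ! 0} \<in> E" "\<forall>i<k. {q ! i, q ! Suc i} \<in> E"
    using q(1) by (force, auto)
  have "q \<in> walks V E k (hd q) y"
    using p q e by (auto simp: walks_def split: if_splits)
  moreover have "q ! 0 = hd q" using q(2) by (cases q) auto
  ultimately show "p \<in> (\<Union>z\<in>{z. {x, z} \<in> E}. (#) x ` walks V E k z y)" using q e by auto
next
  fix p assume "p \<in> (\<Union>z\<in>{z. {x, z} \<in> E}. (#) x ` walks V E k z y)"
  then obtain z q where z: "{x, z} \<in> E" "p = x # q" "q \<in> walks V E k z y" by auto
  have "q \<noteq> []" using z(3) by (auto simp: walks_def)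
  then have "q ! 0 = z" using z(3) by (cases q) (auto simp: walks_def)
  then have "{p ! i, p ! Suc i} \<in> E" if "i < Suc k" for i
    using z that by (cases i) (auto simp: walks_def)
  then show "p \<in> walks V E (Suc k) x y" using z assms \<open>q \<noteq> []\<close> by (auto simp: walks_def)
qed

lemma finite_walks: "finite (walks V E k x y)"
proof (rule finite_subset)
  show "walks V E k x y \<subseteq> {p. set p \<subseteq> V \<and> length p = Suc k}" by (auto simp: walks_def)
  show "finite {p. set p \<subseteq> V \<and> length p = Suc k}" using finite_V by (rule finite_lists_length_eq)
qed

lemma adjacency_power_eq_card_walks:
  "x \<in> V \<Longrightarrow> (adjacency E ^^ k) (indicator {y}) x = real (card (walks V E k x y))"
proof (induction k arbitrary: x)
  case 0
  then show ?case by (simp add: walks_0 indicator_def)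
next
  case (Suc k)
  have disj: "walks V E k z y \<inter> walks V E k z' y = {}" if "z \<noteq> z'" for z z'
    using that by (auto simp: walks_def)
  have "card (walks V E (Suc k) x y) = (\<Sum>z | {x, z} \<in> E. card ((#) x ` walks V E k z y))"
    unfolding walks_Suc[OF Suc.prems]
    by (rule card_UN_disjoint) (use finite_nbrs finite_walks disj in \<open>fastforce+\<close>)
  also have "\<dots> = (\<Sum>z | {x, z} \<in> E. card (walks V E k z y))"
    by (simp add: card_image)
  finally show ?case
    using Suc.IH edge_in_V by (simp add: adjacency_def)
qed

end

section \<open>Kernel and range of the Laplacian on a connected graph\<close>

locale connected_finite_graph = finite_graph +
  assumes conn: "connected_graph V E"
begin

lemma edge_invariant_imp_constant:
  assumes "\<And>x y. {x, y} \<in> E \<Longrightarrow> f x = f y" "x \<in> V" "y \<in> V"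
  shows "f x = f y"
proof -
  obtain k p where p: "p \<in> walks V E k x y"
    using conn assms(2,3) unfolding connected_graph_def by blast
  have "f (p ! i) = f x" if "i \<le> k" for i
    using that
  proof (induction i)
    case 0
    then show ?case using p by (cases p) (auto simp: walks_def)
  next
    case (Suc i)
    then have "{p ! i, p ! Suc i} \<in> E" using p by (simp add: walks_def)
    then show ?case using assms(1) Suc by fastforce
  qed
  then have "f (p ! k) = f x" by simp
  moreover have "p ! k = y" using p by (cases p) (auto simp: walks_def last_conv_nth)
  ultimately show ?thesis by simp
qed

lemma degree_pos:
  assumes "x \<in> V" "y \<in> V" "x \<noteq> y"
  shows "degree E x > 0"
proof (rule ccontr)
  assume "\<not> degree E x > 0"
  then have "{z. {x, z} \<in> E} = {}" using finite_nbrs[of x] by (simp add: degree_def)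
  then have "{x, z} \<notin> E" "{z, x} \<notin> E" for z by (auto simp: insert_commute)
  \<comment> \<open>No edge meets an isolated \<open>x\<close>, so being equal to \<open>x\<close>
    is invariant along edges; connectedness then forces \<open>y = x\<close>.\<close>
  then have "(u = x) = (w = x)" if "{u, w} \<in> E" for u w using that by metis
  from edge_invariant_imp_constant[of "\<lambda>u. u = x", OF this assms(1,2)] assms(3)
  show False by auto
qed

text \<open>The energy of \<open>f\<close> is zero and half a sum of squares, so \<open>f\<close>
  agrees at the ends of every edge.\<close>

lemma laplacian_zero_imp_constant:
  assumes "\<And>x. x \<in> V \<Longrightarrow> laplacian E f x = 0" "x \<in> V" "y \<in> V"
  shows "f x = f y"
proof (rule edge_invariant_imp_constant[OF _ assms(2,3)])
  fix u w assume uw: "{u, w} \<in> E"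
  let ?F = "\<lambda>x y. if {x, y} \<in> E then (f x - f y) * (f x - f y) else 0"
  have "(\<Sum>x\<in>V. \<Sum>y\<in>V. ?F x y) = 0" using dirichlet_form[of f f] assms(1) by simp
  then have "\<forall>x\<in>V. (\<Sum>y\<in>V. ?F x y) = 0"
    by (subst (asm) sum_nonneg_eq_0_iff) (auto intro!: sum_nonneg finite_V)
  then have "(\<Sum>y\<in>V. ?F u y) = 0" using edge_in_V[OF uw] by blast
  then have "\<forall>y\<in>V. ?F u y = 0"
    by (subst (asm) sum_nonneg_eq_0_iff) (auto intro!: finite_V)
  then show "f u = f w" using edge_in_V[OF uw] uw by fastforce
qed

text \<open>From a linear relation among the iterates \<open>L\<^sup>k f\<close>, powers of \<open>L\<close> are cancelled, since \<open>L\<close> is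
  injective on functions of sum zero, until the coefficient of \<open>f\<close> itself is nonzero.\<close>

lemma krylov_step:
  assumes "(\<Sum>x\<in>V. f x) = 0" "\<exists>k\<le>N. c k \<noteq> 0"
    "\<And>x. x \<in> V \<Longrightarrow> (\<Sum>k\<le>N. c k * (laplacian E ^^ k) f x) = 0"
  shows "\<exists>n e. \<forall>x\<in>V. f x = (\<Sum>k<n. e k * (laplacian E ^^ Suc k) f x)"
  using assms(2,3)
proof (induction N arbitrary: c)
  case 0
  then show ?case by (intro exI[of _ 0]) auto
next
  case (Suc N)
  have split: "(\<Sum>k\<le>Suc N. c k * (laplacian E ^^ k) f x)
      = c 0 * f x + (\<Sum>k\<le>N. c (Suc k) * (laplacian E ^^ Suc k) f x)" for x
    by (subst sum.atMost_Suc_shift) simp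
  show ?case
  proof (cases "c 0 = 0")
    case False
    show ?thesis
    proof (intro exI[of _ "Suc N"] exI[of _ "\<lambda>k. - c (Suc k) / c 0"] ballI)
      fix x assume "x \<in> V"
      from Suc.prems(2)[OF this] False
      have "f x = - (\<Sum>k\<le>N. c (Suc k) * (laplacian E ^^ Suc k) f x) / c 0"
        unfolding split by (simp add: field_simps)
      also have "\<dots> = (\<Sum>k<Suc N. - c (Suc k) / c 0 * (laplacian E ^^ Suc k) f x)"
        by (simp add: sum_divide_distrib sum_negf lessThan_Suc_atMost)
      finally show "f x = (\<Sum>k<Suc N. - c (Suc k) / c 0 * (laplacian E ^^ Suc k) f x)" .
    qed
  next
    case True
    define g where "g x = (\<Sum>k\<le>N. c (Suc k) * (laplacian E ^^ k) f x)" for x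
    have "laplacian E g = (\<lambda>x. \<Sum>k\<le>N. c (Suc k) * (laplacian E ^^ Suc k) f x)"
      unfolding g_def[abs_def] by (simp add: laplacian_sum)
    then have "laplacian E g x = 0" if "x \<in> V" for x
      using Suc.prems(2)[OF that] True unfolding split by simp
    then have const: "g x = g y" if "x \<in> V" "y \<in> V" for x y
      using laplacian_zero_imp_constant that by blast
    have "(\<Sum>x\<in>V. (laplacian E ^^ k) f x) = 0" for k
      using assms(1) sum_laplacian by (cases k) auto
    then have "(\<Sum>x\<in>V. g x) = 0"
      unfolding g_def by (subst sum.swap) (simp flip: sum_distrib_left)
    moreover have "(\<Sum>x\<in>V. g x) = real (card V) * g y" if "y \<in> V" for y
      using const[OF _ that] by simp
    ultimately have g0: "g y = 0" if "y \<in> V" for y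
      using that finite_V by fastforce
    have "\<exists>k\<le>N. c (Suc k) \<noteq> 0"
      using Suc.prems(1) True by (metis Suc_le_mono not0_implies_Suc)
    from Suc.IH[OF this] g0 show ?thesis by (simp add: g_def)
  qed
qed

text \<open>The first \<open>card V + 1\<close> iterates, as functions on \<open>card V\<close>
  points, are dependent. Every term on the right carries a factor of the Laplacian; splitting one
  off solves Poisson's equation.\<close>

lemma krylov:
  assumes "(\<Sum>x\<in>V. f x) = 0"
  shows "\<exists>n e. \<forall>x\<in>V. f x = (\<Sum>k<n. e k * (laplacian E ^^ Suc k) f x)"
proof -
  obtain c where "\<exists>k\<in>{..card V}. c k \<noteq> 0"
    "\<forall>x\<in>V. (\<Sum>k\<le>card V. c k * (laplacian E ^^ k) f x) = 0"
    using linear_dependence[OF finite_V, of "{..card V}" "\<lambda>k. (laplacian E ^^ k) f"] by auto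
  then show ?thesis using krylov_step[OF assms, of "card V" c] by auto
qed

lemma laplacian_surj:
  assumes "(\<Sum>x\<in>V. f x) = 0"
  obtains g where "\<And>x. x \<in> V \<Longrightarrow> laplacian E g x = f x"
proof -
  obtain n e where "\<forall>x\<in>V. f x = (\<Sum>k<n. e k * (laplacian E ^^ Suc k) f x)"
    using krylov[OF assms] by blast
  then have "laplacian E (\<lambda>x. \<Sum>k<n. e k * (laplacian E ^^ k) f x) x = f x" if "x \<in> V" for x
    using that by (simp add: laplacian_sum)
  then show ?thesis using that by blast
qed

text \<open>Two unit-current voltages differ by a function with zero Laplacian, hence by a constant,
  so the definite description is met by any of them.\<close>

lemma effective_resistance_eq:
  assumes "unit_current_voltage V E a b v" "a \<in> V" "b \<in> V"
  shows "effective_resistance V E a b = v a - v b"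
  unfolding effective_resistance_def
proof (rule the_equality)
  show "\<exists>w. unit_current_voltage V E a b w \<and> v a - v b = w a - w b" using assms by blast
next
  fix r assume "\<exists>w. unit_current_voltage V E a b w \<and> r = w a - w b"
  then obtain w where w: "unit_current_voltage V E a b w" "r = w a - w b" by blast
  have "laplacian E (\<lambda>x. w x - v x) x = 0" if "x \<in> V" for x
    using w(1) assms(1) that unfolding laplacian_diff
    by (simp add: unit_current_voltage_def laplacian_def)
  from laplacian_zero_imp_constant[OF this assms(2,3)] w(2) show "r = v a - v b" by simp
qed

end

subsection \<open>Walk-regular graphs\<close>

context finite_graph
begin

text \<open>Extends the definition to lengths 0 and 1: only the trivial walk, and none because there
  are no loops.\<close>

lemma walk_regular_closed_walks:
  assumes "walk_regular V E" "x \<in> V" "y \<in> V"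
  shows "card (walks V E k x x) = card (walks V E k y y)"
proof -
  consider "k = 0" | "k = 1" | "k \<ge> 2" by linarith
  then show ?thesis
  proof cases
    case 1
    then show ?thesis using assms by (simp add: walks_0)
  next
    case 2
    have "walks V E 1 u u = {}" for u
    proof -
      have "False" if "p \<in> walks V E 1 u u" for p
      proof -
        from that obtain v w where "p = [v, w]" by (auto simp: walks_def length_Suc_conv)
        with that edge_in_V[of u u] show False by (auto simp: walks_def)
      qed
      then show ?thesis by blast
    qed
    then show ?thesis using 2 by simp
  next
    case 3
    then show ?thesis using assms unfolding walk_regular_def by blast
  qed
qed

text \<open>A closed walk of length 2 goes to a neighbour and back, so the degree counts these
  walks.\<close>

lemma walk_regular_degree:
  assumes "walk_regular V E" "x \<in> V" "y \<in> V"
  shows "degree E x = degree E y"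
proof -
  have "real (degree E u) = (adjacency E ^^ 2) (indicator {u}) u" for u
  proof -
    have "adjacency E (indicator {u}) z = 1" if "{u, z} \<in> E" for z
    proof -
      have "adjacency E (indicator {u}) z = (\<Sum>y\<in>{u}. 1)"
        unfolding adjacency_def
        by (rule sum.mono_neutral_cong_right)
          (use finite_nbrs[of z] that in \<open>auto simp: insert_commute indicator_def\<close>)
      then show ?thesis by simp
    qed
    then have "adjacency E (adjacency E (indicator {u})) u = (\<Sum>z | {u, z} \<in> E. 1)"
      by (subst (1) adjacency_def) (rule sum.cong, auto)
    then show ?thesis by (simp add: degree_def numeral_2_eq_2)
  qed
  then show ?thesis
    using walk_regular_closed_walks[OF assms, of 2] adjacency_power_eq_card_walks assms(2,3)
    by (metis of_nat_eq_iff)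
qed

text \<open>The factor \<open>A\<^sup>j\<close> carries the induction: in a regular graph \<open>L A\<^sup>j = d A\<^sup>j - A\<^sup>j\<^sup>+\<^sup>1\<close>.\<close>

lemma walk_regular_laplacian_power_diagonal:
  assumes wr: "walk_regular V E" and xy: "x \<in> V" "y \<in> V"
  shows "(laplacian E ^^ k) ((adjacency E ^^ j) (indicator {x})) x
       = (laplacian E ^^ k) ((adjacency E ^^ j) (indicator {y})) y"
proof (induction k arbitrary: j)
  case 0
  then show ?case
    using walk_regular_closed_walks[OF assms] xy by (simp add: adjacency_power_eq_card_walks)
next
  case (Suc k)
  define d where "d = real (degree E x)"
  have step: "(laplacian E ^^ Suc k) ((adjacency E ^^ j) (indicator {u})) u
      = d * (laplacian E ^^ k) ((adjacency E ^^ j) (indicator {u})) u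
        - (laplacian E ^^ k) ((adjacency E ^^ Suc j) (indicator {u})) u"
    if u: "u \<in> V" for u
  proof -
    have "laplacian E ((adjacency E ^^ j) (indicator {u}))
        = (\<lambda>z. d * (adjacency E ^^ j) (indicator {u}) z - (adjacency E ^^ Suc j) (indicator {u}) z)"
    proof
      fix z
      show "laplacian E ((adjacency E ^^ j) (indicator {u})) z
          = d * (adjacency E ^^ j) (indicator {u}) z - (adjacency E ^^ Suc j) (indicator {u}) z"
        using walk_regular_degree[OF wr xy(1), of z] adjacency_power_outside[OF u, of z j]
        by (cases "z \<in> V") (auto simp: laplacian_eq d_def)
    qed
    then show ?thesis
      by (simp only: funpow_Suc_right o_apply laplacian_power_diff laplacian_power_scale)
  qed
  show ?case unfolding step[OF xy(1)] step[OF xy(2)] Suc.IH ..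
qed

end

context connected_finite_graph
begin

lemma walk_regular_voltage:
  assumes wr: "walk_regular V E" and ab: "a \<in> V" "b \<in> V" "a \<noteq> b"
  obtains v where "unit_current_voltage V E a b v" "(\<Sum>x\<in>V. v x) = 0" "v a + v b = 0"
proof -
  define f :: "'a \<Rightarrow> real" where "f = (\<lambda>x. indicator {a} x - indicator {b} x)"
  have "(\<Sum>x\<in>V. f x) = 0"
    using sum_times_dipole[OF ab(1,2), of "\<lambda>_. 1"] by (simp add: f_def)
  then have sumf: "(\<Sum>x\<in>V. (laplacian E ^^ k) f x) = 0" for k
    using sum_laplacian by (cases k) auto
  obtain n e where e: "\<And>x. x \<in> V \<Longrightarrow> f x = (\<Sum>k<n. e k * (laplacian E ^^ Suc k) f x)"
    using krylov[OF sumf[of 0, simplified]] by auto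
  define v where "v = (\<lambda>x. \<Sum>k<n. e k * (laplacian E ^^ k) f x)"
  have "laplacian E v x = f x" if "x \<in> V" for x
    using e[OF that] unfolding v_def by (simp add: laplacian_sum)
  then have "unit_current_voltage V E a b v"
    using ab(3) by (auto simp: unit_current_voltage_def laplacian_def f_def)
  moreover have "(\<Sum>x\<in>V. v x) = 0"
    unfolding v_def by (subst sum.swap) (simp add: sumf flip: sum_distrib_left)
  \<comment> \<open>The matrix of the \<open>k\<close>-th power is symmetric and, by
    walk-regularity, has equal diagonal entries at \<open>a\<close> and \<open>b\<close>; its four
    entries occur here with signs that cancel in pairs.\<close>
  moreover have "(laplacian E ^^ k) f a + (laplacian E ^^ k) f b = 0" for k
    using walk_regular_laplacian_power_diagonal[OF wr ab(1,2), of k 0]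
      laplacian_power_self_adjoint[of "indicator {a}" k "indicator {b}"]
    unfolding f_def laplacian_power_diff sum_indicator_times[OF ab(1)] sum_indicator_times[OF ab(2)]
    by simp
  then have "v a + v b = 0"
    unfolding v_def sum.distrib[symmetric] distrib_left[symmetric] by simp
  ultimately show ?thesis using that by blast
qed

end

context connected_finite_graph
begin

lemma laplacian_voltage:
  assumes "unit_current_voltage V E a b v" "a \<noteq> b" "x \<in> V"
  shows "laplacian E v x = indicator {a} x - indicator {b} x"
  using assms by (auto simp: unit_current_voltage_def laplacian_def)

text \<open>The energy of \<open>v - t \<delta>\<^sub>a\<close> is \<open>(v a - v b) - 2 t + t\<^sup>2 d\<close>, minimal at \<open>t = 1 / d\<close>.\<close>

lemma effective_resistance_lower_bound:
  assumes v: "unit_current_voltage V E a b v" and ab: "a \<in> V" "b \<in> V" "a \<noteq> b"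
  shows "real (degree E a) * (v a - v b) \<ge> 1"
proof -
  define d where "d = real (degree E a)"
  have d: "d > 0" using degree_pos[OF ab] by (simp add: d_def)
  define \<delta> :: "'a \<Rightarrow> real" where "\<delta> = indicator {a}"
  define w where "w = (\<lambda>x. v x - (1 / d) * \<delta> x)"
  have sum_\<delta>: "(\<Sum>x\<in>V. \<delta> x * g x) = g a" for g
    unfolding \<delta>_def by (rule sum_indicator_times[OF ab(1)])
  note Lv = laplacian_voltage[OF v ab(3)]
  have vLv: "(\<Sum>x\<in>V. v x * laplacian E v x) = v a - v b"
    using sum_times_dipole[OF ab(1,2), of v] by (simp add: Lv)
  have \<delta>Lv: "(\<Sum>x\<in>V. \<delta> x * laplacian E v x) = 1"
    using Lv[OF ab(1)] ab(3) by (simp add: sum_\<delta>)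
  have \<delta>L\<delta>: "(\<Sum>x\<in>V. \<delta> x * laplacian E \<delta> x) = d"
  proof -
    have "{a, a} \<notin> E" using edge_in_V by blast
    then have "laplacian E \<delta> a = (\<Sum>y | {a, y} \<in> E. 1)"
      unfolding laplacian_def \<delta>_def by (intro sum.cong) (auto simp: indicator_def)
    then show ?thesis by (simp add: sum_\<delta> d_def degree_def)
  qed
  have "(\<Sum>x\<in>V. w x * laplacian E w x)
      = (\<Sum>x\<in>V. v x * laplacian E v x) - (1 / d) * (\<Sum>x\<in>V. \<delta> x * laplacian E v x)
        - (1 / d) * (\<Sum>x\<in>V. v x * laplacian E \<delta> x)
        + (1 / d) * (1 / d) * (\<Sum>x\<in>V. \<delta> x * laplacian E \<delta> x)"
    unfolding w_def laplacian_diff laplacian_scale sum_distrib_left sum_subtractf[symmetric]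
      sum.distrib[symmetric]
    by (intro sum.cong) (simp_all add: algebra_simps)
  also have "\<dots> = (v a - v b) - 1 / d"
    using d unfolding laplacian_self_adjoint[of v \<delta>] vLv \<delta>Lv \<delta>L\<delta> by simp
  finally have "(v a - v b) - 1 / d \<ge> 0" using laplacian_energy_nonneg[of w] by simp
  then show ?thesis using d by (simp add: d_def field_simps)
qed

end

subsection \<open>Expected hitting times\<close>

lemma less_hitting_time_iff: "enat t < hitting_time X b \<omega> \<longleftrightarrow> (\<forall>i\<le>t. X i \<omega> \<noteq> b)"
proof
  assume t: "enat t < hitting_time X b \<omega>"
  show "\<forall>i\<le>t. X i \<omega> \<noteq> b"
  proof (intro allI impI notI)
    fix i assume i: "i \<le> t" "X i \<omega> = b"
    then have "hitting_time X b \<omega> \<le> enat i"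
      unfolding hitting_time_def by (intro Inf_lower) auto
    also have "\<dots> \<le> enat t" using i by simp
    finally show False using t by simp
  qed
next
  assume "\<forall>i\<le>t. X i \<omega> \<noteq> b"
  then have "enat (Suc t) \<le> hitting_time X b \<omega>"
    unfolding hitting_time_def by (intro Inf_greatest) (auto simp: not_less_eq_eq[symmetric])
  then show "enat t < hitting_time X b \<omega>"
    by (meson enat_ord_simps(2) lessI less_le_trans)
qed

text \<open>Describes each level set of the hitting time, the infinite one included, by countably
  many tail events; measurability follows from this.\<close>

lemma enat_eqI:
  assumes "\<And>t. enat t < m \<longleftrightarrow> enat t < n"
  shows "m = n"
proof (rule linorder_cases[of m n])
  assume "m < n"
  then obtain t where "m = enat t" by (cases m) auto
  with \<open>m < n\<close> assms[of t] show ?thesis by simp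
next
  assume "n < m"
  then obtain t where "n = enat t" by (cases n) auto
  with \<open>n < m\<close> assms[of t] show ?thesis by simp
qed

section \<open>The walk killed at its target\<close>

locale random_walk = connected_finite_graph +
  fixes a b :: 'a and M :: "'m measure" and X :: "nat \<Rightarrow> 'm \<Rightarrow> 'a"
  assumes srw: "simple_random_walk V E a M X"
    and a_in_V: "a \<in> V" and b_in_V: "b \<in> V" and a_neq_b: "a \<noteq> b"
begin

sublocale prob_space M using srw by (simp add: simple_random_walk_def)

lemma X_in_V: "\<omega> \<in> space M \<Longrightarrow> X i \<omega> \<in> V"
  using srw measurable_space[of "X i" M "count_space V" \<omega>] by (simp add: simple_random_walk_def)

lemma X_measurable[measurable]: "X i \<in> measurable M (count_space UNIV)"
proof -
  have "X i \<in> measurable M (count_space V)" using srw by (simp add: simple_random_walk_def)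
  moreover have "id \<in> measurable (count_space V) (count_space UNIV)" by simp
  ultimately have "id \<circ> X i \<in> measurable M (count_space UNIV)" by (rule measurable_comp)
  then show ?thesis by simp
qed

definition survival :: "nat \<Rightarrow> real" where
  "survival j = \<P>(\<omega> in M. \<forall>i\<le>j. X i \<omega> \<noteq> b)"

definition killed :: "nat \<Rightarrow> 'a \<Rightarrow> real" where
  "killed j x = \<P>(\<omega> in M. (\<forall>i\<le>j. X i \<omega> \<noteq> b) \<and> X j \<omega> = x)"

text \<open>The product form of the Markov property also holds for null histories, on which the
  conditional form is silent: both sides are then zero.\<close>

lemma history_step:
  assumes "z \<in> V"
  shows "\<P>(\<omega> in M. (\<forall>i\<le>j. X i \<omega> = p i) \<and> X (Suc j) \<omega> = z)
    = \<P>(\<omega> in M. \<forall>i\<le>j. X i \<omega> = p i) * transition_prob E (p j) z"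
proof (cases "\<P>(\<omega> in M. \<forall>i\<le>j. X i \<omega> = p i) = 0")
  case True
  have "\<P>(\<omega> in M. (\<forall>i\<le>j. X i \<omega> = p i) \<and> X (Suc j) \<omega> = z) \<le> \<P>(\<omega> in M. \<forall>i\<le>j. X i \<omega> = p i)"
    by (rule finite_measure_mono) auto
  with True show ?thesis by (simp add: measure_le_0_iff)
next
  case False
  then have "\<P>(\<omega> in M. \<forall>i\<le>j. X i \<omega> = p i) > 0" by (simp add: zero_less_measure_iff)
  with srw assms have
    "\<P>(\<omega> in M. X (Suc j) \<omega> = z \<bar> \<forall>i\<le>j. X i \<omega> = p i) = transition_prob E (p j) z"
    by (simp add: simple_random_walk_def)
  with False show ?thesis by (simp add: cond_prob_def field_simps conj_commute)
qed

text \<open>The event is split by the positions at times 0 to \<open>j\<close>. Taking paths as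
  extensional functions on \<open>{..j}\<close> makes them finite in number and unique for each
  outcome. The slot \<open>C\<close> serves for the next step.\<close>

lemma sum_over_histories:
  assumes [measurable]: "Measurable.pred M C"
  shows "\<P>(\<omega> in M. (\<forall>i\<le>j. X i \<omega> \<noteq> b) \<and> X j \<omega> = x \<and> C \<omega>)
    = (\<Sum>p | p \<in> {..j} \<rightarrow>\<^sub>E V - {b} \<and> p j = x. \<P>(\<omega> in M. (\<forall>i\<le>j. X i \<omega> = p i) \<and> C \<omega>))"
proof (rule prob_sum)
  show "finite {p \<in> {..j} \<rightarrow>\<^sub>E V - {b}. p j = x}"
    by (rule finite_subset[of _ "{..j} \<rightarrow>\<^sub>E V - {b}"]) (auto intro!: finite_PiE finite_V)
  have uniq: "\<exists>!p. p \<in> {p \<in> {..j} \<rightarrow>\<^sub>E V - {b}. p j = x} \<and> ((\<forall>i\<le>j. X i \<omega> = p i) \<and> C \<omega>)"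
    if "\<omega> \<in> space M" "\<forall>i\<le>j. X i \<omega> \<noteq> b" "X j \<omega> = x" "C \<omega>" for \<omega>
  proof (rule ex1I[of _ "restrict (\<lambda>i. X i \<omega>) {..j}"])
    show "restrict (\<lambda>i. X i \<omega>) {..j} \<in> {p \<in> {..j} \<rightarrow>\<^sub>E V - {b}. p j = x} \<and>
        ((\<forall>i\<le>j. X i \<omega> = restrict (\<lambda>i. X i \<omega>) {..j} i) \<and> C \<omega>)"
      using that X_in_V by auto
    fix p assume "p \<in> {p \<in> {..j} \<rightarrow>\<^sub>E V - {b}. p j = x} \<and> ((\<forall>i\<le>j. X i \<omega> = p i) \<and> C \<omega>)"
    then show "p = restrict (\<lambda>i. X i \<omega>) {..j}"
      by (auto simp: PiE_def extensional_def fun_eq_iff)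
  qed
  have hist: "(\<forall>i\<le>j. X i \<omega> \<noteq> b) \<and> X j \<omega> = x \<and> C \<omega>"
    if "p \<in> {p \<in> {..j} \<rightarrow>\<^sub>E V - {b}. p j = x}" "(\<forall>i\<le>j. X i \<omega> = p i) \<and> C \<omega>" for p \<omega>
    using that by (auto simp: PiE_def Pi_def)
  show "AE \<omega> in M.
      (\<forall>p\<in>{p \<in> {..j} \<rightarrow>\<^sub>E V - {b}. p j = x}. (\<forall>i\<le>j. X i \<omega> = p i) \<and> C \<omega> \<longrightarrow>
        (\<forall>i\<le>j. X i \<omega> \<noteq> b) \<and> X j \<omega> = x \<and> C \<omega>) \<and>
      ((\<forall>i\<le>j. X i \<omega> \<noteq> b) \<and> X j \<omega> = x \<and> C \<omega> \<longrightarrow>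
        (\<exists>!p. p \<in> {p \<in> {..j} \<rightarrow>\<^sub>E V - {b}. p j = x} \<and> ((\<forall>i\<le>j. X i \<omega> = p i) \<and> C \<omega>)))"
    by (rule AE_I2, rule conjI, intro ballI impI, erule (1) hist, rule impI, elim conjE,
        rule uniq, assumption+)
qed measurable

text \<open>The walk is specified through full histories; summing over those that avoid
  \<open>b\<close> and end at \<open>x\<close> leaves a rule depending on \<open>x\<close>
  only.\<close>

lemma killed_step:
  assumes "z \<in> V"
  shows "\<P>(\<omega> in M. (\<forall>i\<le>j. X i \<omega> \<noteq> b) \<and> X j \<omega> = x \<and> X (Suc j) \<omega> = z)
    = killed j x * transition_prob E x z"
proof -
  have "\<P>(\<omega> in M. (\<forall>i\<le>j. X i \<omega> \<noteq> b) \<and> X j \<omega> = x \<and> X (Suc j) \<omega> = z)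
      = (\<Sum>p | p \<in> {..j} \<rightarrow>\<^sub>E V - {b} \<and> p j = x.
          \<P>(\<omega> in M. (\<forall>i\<le>j. X i \<omega> = p i) \<and> X (Suc j) \<omega> = z))"
    by (rule sum_over_histories) measurable
  also have "\<dots> = (\<Sum>p | p \<in> {..j} \<rightarrow>\<^sub>E V - {b} \<and> p j = x.
          \<P>(\<omega> in M. \<forall>i\<le>j. X i \<omega> = p i) * transition_prob E x z)"
    by (intro sum.cong) (auto simp: history_step[OF assms])
  also have "\<dots> = killed j x * transition_prob E x z"
    using sum_over_histories[of "\<lambda>_. True" j x] by (simp add: killed_def sum_distrib_right)
  finally show ?thesis .
qed

text \<open>Forward equation, split by the position at time \<open>j\<close>; mass arriving at
  \<open>b\<close> is removed, hence \<open>z \<noteq> b\<close>.\<close>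

lemma killed_Suc:
  assumes "z \<in> V" "z \<noteq> b"
  shows "killed (Suc j) z = (\<Sum>x\<in>V. killed j x * transition_prob E x z)"
proof -
  have "killed (Suc j) z
      = (\<Sum>x\<in>V. \<P>(\<omega> in M. (\<forall>i\<le>j. X i \<omega> \<noteq> b) \<and> X j \<omega> = x \<and> X (Suc j) \<omega> = z))"
    unfolding killed_def
  proof (rule prob_sum[OF finite_V])
    show "AE \<omega> in M.
      (\<forall>x\<in>V. (\<forall>i\<le>j. X i \<omega> \<noteq> b) \<and> X j \<omega> = x \<and> X (Suc j) \<omega> = z \<longrightarrow>
        (\<forall>i\<le>Suc j. X i \<omega> \<noteq> b) \<and> X (Suc j) \<omega> = z) \<and>
      ((\<forall>i\<le>Suc j. X i \<omega> \<noteq> b) \<and> X (Suc j) \<omega> = z \<longrightarrow>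
        (\<exists>!x. x \<in> V \<and> ((\<forall>i\<le>j. X i \<omega> \<noteq> b) \<and> X j \<omega> = x \<and> X (Suc j) \<omega> = z)))"
      using assms X_in_V by (intro AE_I2) (auto simp: le_Suc_eq)
  qed measurable
  then show ?thesis by (simp add: killed_step[OF assms(1)])
qed

lemma survival_eq_sum: "survival j = (\<Sum>x\<in>V. killed j x)"
  unfolding survival_def killed_def
proof (rule prob_sum[OF finite_V])
  show "AE \<omega> in M. (\<forall>x\<in>V. (\<forall>i\<le>j. X i \<omega> \<noteq> b) \<and> X j \<omega> = x \<longrightarrow> (\<forall>i\<le>j. X i \<omega> \<noteq> b)) \<and>
      ((\<forall>i\<le>j. X i \<omega> \<noteq> b) \<longrightarrow> (\<exists>!x. x \<in> V \<and> ((\<forall>i\<le>j. X i \<omega> \<noteq> b) \<and> X j \<omega> = x)))"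
    using X_in_V by (intro AE_I2) auto
qed measurable

lemma killed_0: "killed 0 x = indicator {a} x"
proof -
  have "\<P>(\<omega> in M. X 0 \<omega> = a) = 1" using srw by (simp add: simple_random_walk_def)
  then have ae: "AE \<omega> in M. X 0 \<omega> = a" by (subst (asm) prob_Collect_eq_1) measurable
  have "killed 0 x = \<P>(\<omega> in M. x = a)"
    unfolding killed_def
    by (rule prob_eq_AE) (use ae a_neq_b in \<open>auto elim!: eventually_mono\<close>)
  then show ?thesis by (auto simp: prob_space indicator_def)
qed

lemma killed_target: "killed j b = 0"
proof -
  have "{\<omega> \<in> space M. (\<forall>i\<le>j. X i \<omega> \<noteq> b) \<and> X j \<omega> = b} = {}" by auto
  then show ?thesis unfolding killed_def by (simp only: measure_empty)
qed

lemma killed_nonneg: "killed j x \<ge> 0"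
  by (simp add: killed_def)

lemma transition_prob_sum:
  "(\<Sum>z\<in>V. transition_prob E x z * h z) = adjacency E h x / real (degree E x)"
  unfolding adjacency_def sum_nbrs sum_divide_distrib
  by (intro sum.cong) (auto simp: transition_prob_def)

lemma expected_hitting_time_eq_suminf:
  "expected_hitting_time M X b = (\<Sum>t. ennreal (survival t))"
proof -
  have "hitting_time X b \<in> measurable M (count_space UNIV)"
  proof (rule measurable_count_space_eq2_countable[THEN iffD2], safe)
    fix m :: enat
    have "hitting_time X b -` {m} \<inter> space M
        = {\<omega>\<in>space M. \<forall>t. (\<forall>i\<le>t. X i \<omega> \<noteq> b) \<longleftrightarrow> enat t < m}"
      by (auto simp: less_hitting_time_iff[symmetric] intro: enat_eqI)
    also have "\<dots> \<in> sets M" by measurable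
    finally show "hitting_time X b -` {m} \<inter> space M \<in> sets M" .
  qed auto
  then show ?thesis
    unfolding expected_hitting_time_def survival_def
    by (simp add: nn_integral_enat_function less_hitting_time_iff emeasure_eq_measure)
qed

text \<open>The killed mean \<open>H j\<close> of \<open>h\<close> drops by \<open>survival j = P(T\<^sub>b > j)\<close> in each step. As \<open>|H j|\<close> is at most
  a constant times \<open>survival j\<close>, the partial sums of \<open>survival\<close> are bounded, so \<open>H j\<close> tends to \<open>0\<close>
  and the sum is \<open>H 0 = h a\<close>.\<close>

lemma expected_hitting_time_harmonic:
  assumes h: "\<And>x. x \<in> V \<Longrightarrow> x \<noteq> b \<Longrightarrow> laplacian E h x = real (degree E x)" and hb: "h b = 0"
  shows "expected_hitting_time M X b = ennreal (h a)"
proof -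
  define H where "H j = (\<Sum>x\<in>V. killed j x * h x)" for j
  \<comment> \<open>First-step equation, obtained by dividing the Laplacian identity by the
    degree.\<close>
  have mean: "(\<Sum>z\<in>V. transition_prob E x z * h z) = h x - 1" if "x \<in> V" "x \<noteq> b" for x
    using degree_pos[OF that(1) b_in_V that(2)] h[OF that]
    unfolding transition_prob_sum laplacian_eq by (simp add: field_simps)
  have H_Suc: "H (Suc j) = H j - survival j" for j
  proof -
    \<comment> \<open>The forward equation excludes \<open>z = b\<close>, but that term vanishes
      because \<open>h b = 0\<close>.\<close>
    have "H (Suc j) = (\<Sum>z\<in>V. (\<Sum>x\<in>V. killed j x * transition_prob E x z) * h z)"
      unfolding H_def using killed_Suc hb by (intro sum.cong) auto
    also have "\<dots> = (\<Sum>x\<in>V. killed j x * (\<Sum>z\<in>V. transition_prob E x z * h z))"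
      unfolding sum_distrib_right sum_distrib_left by (subst sum.swap) (simp add: mult.assoc)
    \<comment> \<open>The first-step equation excludes \<open>x = b\<close>, where there is no
      killed mass.\<close>
    also have "\<dots> = (\<Sum>x\<in>V. killed j x * (h x - 1))"
      using mean killed_target by (intro sum.cong) auto
    finally show ?thesis
      by (simp add: H_def survival_eq_sum right_diff_distrib sum_subtractf)
  qed
  have H_0: "H 0 = h a"
    unfolding H_def killed_0 by (rule sum_indicator_times[OF a_in_V])
  have partial: "(\<Sum>j<n. survival j) = h a - H n" for n
    by (induction n) (simp_all add: H_0 H_Suc)
  define C where "C = (\<Sum>x\<in>V. \<bar>h x\<bar>)"
  have H_bound: "\<bar>H n\<bar> \<le> C * survival n" for n
  proof -
    have "\<bar>H n\<bar> \<le> (\<Sum>x\<in>V. killed n x * \<bar>h x\<bar>)"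
      unfolding H_def using killed_nonneg
      by (intro order_trans[OF sum_abs]) (simp add: abs_mult)
    also have "\<dots> \<le> (\<Sum>x\<in>V. killed n x * C)"
      unfolding C_def using killed_nonneg finite_V
      by (intro sum_mono mult_left_mono member_le_sum) auto
    finally show ?thesis unfolding survival_eq_sum mult.commute[of C] sum_distrib_right .
  qed
  have surv: "survival n \<ge> 0" "survival n \<le> 1" for n by (simp_all add: survival_def)
  have C: "C \<ge> 0" by (simp add: C_def sum_nonneg)
  have "(\<Sum>j<n. survival j) \<le> h a + C" for n
    using partial[of n] H_bound[of n] mult_left_mono[OF surv(2)[of n] C] by simp
  then have summ: "summable survival"
    by (intro summableI_nonneg_bounded) (use surv in auto)
  then have "survival \<longlonglongrightarrow> 0" by (rule summable_LIMSEQ_zero)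
  then have "(\<lambda>n. C * survival n) \<longlonglongrightarrow> 0" by (rule tendsto_mult_right_zero)
  then have "H \<longlonglongrightarrow> 0"
    by (rule Lim_null_comparison[rotated]) (use H_bound in simp)
  then have "(\<lambda>n. h a - H n) \<longlonglongrightarrow> h a - 0" by (intro tendsto_intros)
  then have "survival sums h a" unfolding sums_def partial by simp
  then show ?thesis
    unfolding expected_hitting_time_eq_suminf using surv summ
    by (simp add: suminf_ennreal2 sums_iff)
qed

lemma expected_hitting_time_voltage:
  assumes v: "unit_current_voltage V E a b v"
  shows "expected_hitting_time M X b = ennreal (\<Sum>x\<in>V. real (degree E x) * (v x - v b))"
proof -
  \<comment> \<open>The prescribed Laplacian of the hitting-time function: the degree away from
    \<open>b\<close>, and at \<open>b\<close> a correction making the total zero, as solvability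
    demands. The handshake identity gives its size.\<close>
  define f where "f x = real (degree E x) - 2 * real (card E) * indicator {b} x" for x
  have "(\<Sum>x\<in>V. f x) = 0"
    unfolding f_def sum_subtractf sum_times_indicator[OF b_in_V] real_handshake by simp
  then obtain g where g: "\<And>x. x \<in> V \<Longrightarrow> laplacian E g x = f x"
    using laplacian_surj by blast
  define h where "h = (\<lambda>x. g x - g b)"
  have Lh: "laplacian E h x = f x" if "x \<in> V" for x
    unfolding h_def laplacian_shift by (rule g[OF that])
  have Lv: "laplacian E (\<lambda>x. v x - v b) x = indicator {a} x - indicator {b} x" if "x \<in> V" for x
    unfolding laplacian_shift by (rule laplacian_voltage[OF v a_neq_b that])
  have "h a = (\<Sum>x\<in>V. h x * laplacian E (\<lambda>x. v x - v b) x)"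
    using sum_times_dipole[OF a_in_V b_in_V, of h] by (simp add: Lv h_def)
  also have "\<dots> = (\<Sum>x\<in>V. (v x - v b) * laplacian E h x)" by (rule laplacian_self_adjoint)
  also have "\<dots> = (\<Sum>x\<in>V. real (degree E x) * (v x - v b)
      - 2 * real (card E) * (v x - v b) * indicator {b} x)"
    by (intro sum.cong) (simp_all add: Lh f_def algebra_simps)
  also have "\<dots> = (\<Sum>x\<in>V. real (degree E x) * (v x - v b))"
    unfolding sum_subtractf sum_times_indicator[OF b_in_V] by simp
  finally show ?thesis
    using expected_hitting_time_harmonic[of h] Lh by (simp add: f_def h_def)
qed

end

subsection \<open>Deleting an edge\<close>

text \<open>Only \<open>a\<close> and \<open>b\<close> lose a neighbour: the sum at \<open>a\<close>
  loses the term \<open>f a - f b\<close>, the sum at \<open>b\<close> the term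
  \<open>f b - f a\<close>.\<close>

lemma laplacian_delete_edge:
  assumes fin: "finite {y. {x, y} \<in> E}" and e: "{a, b} \<in> E" "a \<noteq> b"
  shows "laplacian (E - {{a, b}}) f x
    = laplacian E f x - (f a - f b) * (indicator {a} x - indicator {b} x)"
proof -
  have sub: "{y. {x, y} \<in> E - {{a, b}}} = {y. {x, y} \<in> E} - {y. {x, y} = {a, b}}" by auto
  have "laplacian (E - {{a, b}}) f x
      = laplacian E f x - (\<Sum>y | {x, y} = {a, b}. f x - f y)"
    unfolding laplacian_def sub using fin e(1) by (intro sum_diff) auto
  also have "{y. {x, y} = {a, b}} = (if x = a then {b} else if x = b then {a} else {})"
    by (auto simp: doubleton_eq_iff)
  finally show ?thesis using e(2) by (auto simp: algebra_simps split: if_splits)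
qed

lemma degree_delete_edge:
  assumes fin: "finite {y. {x, y} \<in> E}" and e: "{a, b} \<in> E" "a \<noteq> b"
  shows "real (degree (E - {{a, b}}) x)
    = real (degree E x) - indicator {a} x - indicator {b} x"
proof -
  have sub: "{y. {x, y} \<in> E - {{a, b}}} = {y. {x, y} \<in> E} - {y. {x, y} = {a, b}}" by auto
  have "real (card {y. {x, y} \<in> E - {{a, b}}})
      = real (card {y. {x, y} \<in> E}) - real (card {y. {x, y} = {a, b}})"
    using fin e(1) unfolding sub
    by (subst card_Diff_subset) (auto intro!: of_nat_diff card_mono intro: finite_subset)
  also have "{y. {x, y} = {a, b}} = (if x = a then {b} else if x = b then {a} else {})"
    by (auto simp: doubleton_eq_iff)
  finally show ?thesis using e(2) unfolding degree_def by (auto split: if_splits)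
qed

theorem theorem4:
  fixes V :: "'a set" and E E' :: "'a set set" and a b :: 'a and R :: real
    and M :: "'m measure" and X :: "nat \<Rightarrow> 'm \<Rightarrow> 'a"
    and M' :: "'n measure" and X' :: "nat \<Rightarrow> 'n \<Rightarrow> 'a"
  assumes "finite_simple_graph V E"
    and "connected_graph V E"
    and "walk_regular V E"
    and "card V \<ge> 3"
    and "{a, b} \<in> E"
    and "E' = E - {{a, b}}"
    and "connected_graph V E'"
    and "R = effective_resistance V E a b"
    and "simple_random_walk V E a M X"
    and "simple_random_walk V E' a M' X'"
  shows "expected_hitting_time M X b = ennreal (real (card E) * R)
    \<and> expected_hitting_time M' X' b = ennreal ((real (card E) - 1) * R / (1 - R))
    \<and> expected_hitting_time M' X' b =
        ennreal ((enn2real (expected_hitting_time M X b) - R) / (1 - R))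
    \<and> expected_hitting_time M X b < expected_hitting_time M' X' b"
proof -
  interpret G: connected_finite_graph V E by unfold_locales (fact assms)+
  have ab: "a \<in> V" "b \<in> V" "a \<noteq> b" using G.edge_in_V[OF assms(5)] by auto
  have "finite_simple_graph V E'"
    using assms(1,6) by (auto simp: finite_simple_graph_def)
  then interpret G': connected_finite_graph V E' using assms(7) by unfold_locales
  interpret W: random_walk V E a b M X by unfold_locales (fact assms ab)+
  interpret W': random_walk V E' a b M' X' by unfold_locales (fact assms ab)+
  define m where "m = real (card E)"
  define d where "d = real (degree E a)"
  have deg: "real (degree E x) = d" if "x \<in> V" for x
    using G.walk_regular_degree[OF assms(3) that ab(1)] by (simp add: d_def)
  have nd: "real (card V) * d = 2 * m"
    using G.real_handshake deg by (simp add: m_def)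
  obtain v where v: "unit_current_voltage V E a b v" "(\<Sum>x\<in>V. v x) = 0" "v a + v b = 0"
    using G.walk_regular_voltage[OF assms(3) ab] .
  have R: "R = v a - v b" using G.effective_resistance_eq[OF v(1) ab(1,2)] assms(8) by simp
  have Lv: "laplacian E v x = indicator {a} x - indicator {b} x" if "x \<in> V" for x
    using G.laplacian_voltage[OF v(1) ab(3) that] .
  have Lv': "laplacian E' v x = (1 - R) * (indicator {a} x - indicator {b} x)" if "x \<in> V" for x
    unfolding assms(6) laplacian_delete_edge[OF G.finite_nbrs assms(5) ab(3)] Lv[OF that] R
    by (simp add: algebra_simps)
  have dR: "d * R \<ge> 1"
    using G.effective_resistance_lower_bound[OF v(1) ab] by (simp add: d_def R)
  have d_pos: "d > 0" using G.degree_pos[OF ab] by (simp add: d_def)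
  have R_pos: "R > 0" using dR d_pos by (smt (verit) mult_nonneg_nonpos)
  \<comment> \<open>This rests on the edge not being a cut-edge: for \<open>R = 1\<close> the
    voltage would be harmonic on the connected graph \<open>E'\<close>, hence constant, although
    \<open>v a - v b = 1\<close>.\<close>
  have R_neq: "R \<noteq> 1"
  proof
    assume "R = 1"
    then have "laplacian E' v x = 0" if "x \<in> V" for x using Lv'[OF that] by simp
    from G'.laplacian_zero_imp_constant[OF this ab(1,2)] R \<open>R = 1\<close> show False by simp
  qed
  \<comment> \<open>Nonnegativity of this energy excludes \<open>R > 1\<close>.\<close>
  have "(\<Sum>x\<in>V. v x * laplacian E' v x) = (1 - R) * R"
  proof -
    have "(\<Sum>x\<in>V. v x * laplacian E' v x)
        = (\<Sum>x\<in>V. (1 - R) * v x * (indicator {a} x - indicator {b} x))"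
      by (intro sum.cong) (simp_all add: Lv')
    then show ?thesis
      using G.sum_times_dipole[OF ab(1,2), of "\<lambda>x. (1 - R) * v x"]
      by (simp add: R algebra_simps)
  qed
  then have "(1 - R) * R \<ge> 0" using G'.laplacian_energy_nonneg[of v] by simp
  then have R_less: "R < 1" using R_pos R_neq by (simp add: zero_le_mult_iff)
  \<comment> \<open>Three vertices give \<open>2 * m \<ge> 3 * d\<close>, so \<open>m > d\<close>,
    and \<open>d * R \<ge> 1\<close> sharpens to \<open>m * R > 1\<close>, the source of the strict
    increase.\<close>
  have "3 * d \<le> real (card V) * d" using assms(4) d_pos by (intro mult_right_mono) auto
  then have "m > d" using nd d_pos by simp
  then have mR: "m * R > 1"
    using dR R_pos by (meson le_less_trans mult_strict_right_mono)

  have S: "(\<Sum>x\<in>V. real (degree E x) * (v x - v b)) = m * R"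
  proof -
    have "(\<Sum>x\<in>V. real (degree E x) * (v x - v b)) = (\<Sum>x\<in>V. d * v x - d * v b)"
      by (intro sum.cong) (simp_all add: deg right_diff_distrib)
    also have "\<dots> = - (real (card V) * d) * v b"
      by (simp add: sum_subtractf v(2) flip: sum_distrib_left)
    \<comment> \<open>Here \<open>v b = - R / 2\<close>, since \<open>v a + v b = 0\<close> and
      \<open>v a - v b = R\<close>; this halves the degree total \<open>2 * m\<close>.\<close>
    also have "\<dots> = m * R" unfolding nd R using v(3) by (simp add: eq_neg_iff_add_eq_0[symmetric])
    finally show ?thesis .
  qed
  then have hit: "expected_hitting_time M X b = ennreal (m * R)"
    using W.expected_hitting_time_voltage[OF v(1)] by simp

  \<comment> \<open>The deleted edge carried current \<open>R\<close>, leaving \<open>1 - R\<close>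
    for the rest of the network; rescaling restores a unit current.\<close>
  define v' where "v' = (\<lambda>x. 1 / (1 - R) * v x)"
  have "laplacian E' v' x = indicator {a} x - indicator {b} x" if "x \<in> V" for x
    unfolding v'_def laplacian_scale Lv'[OF that] using R_neq by simp
  then have v': "unit_current_voltage V E' a b v'"
    using ab(3) by (auto simp: unit_current_voltage_def laplacian_def)
  have "(\<Sum>x\<in>V. real (degree E' x) * (v' x - v' b)) = (m * R - R) / (1 - R)"
  proof -
    have dv': "v' x - v' b = (v x - v b) / (1 - R)" for x
      by (simp add: v'_def diff_divide_distrib)
    have "(\<Sum>x\<in>V. real (degree E' x) * (v' x - v' b))
        = (\<Sum>x\<in>V. real (degree E x) * (v x - v b) - (v x - v b) * indicator {a} x
            - (v x - v b) * indicator {b} x) / (1 - R)"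
      unfolding sum_divide_distrib assms(6)
        degree_delete_edge[OF G.finite_nbrs assms(5) ab(3)] dv' times_divide_eq_right
      by (intro sum.cong refl arg_cong[where f = "\<lambda>t. t / (1 - R)"]) (simp add: algebra_simps)
    \<comment> \<open>The degree correction at \<open>b\<close> vanishes, and the one at
      \<open>a\<close> subtracts \<open>v a - v b = R\<close>.\<close>
    also have "\<dots> = (m * R - R) / (1 - R)"
      unfolding sum_subtractf S G.sum_times_indicator[OF ab(1)] G.sum_times_indicator[OF ab(2)] by (simp add: R)
    finally show ?thesis .
  qed
  then have hit': "expected_hitting_time M' X' b = ennreal ((m * R - R) / (1 - R))"
    using W'.expected_hitting_time_voltage[OF v'] by simp

  \<comment> \<open>This is the strict increase after clearing the positive denominator
    \<open>1 - R\<close>.\<close>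
  have "R < m * R * R" using mR R_pos by simp
  then have "m * R < (m * R - R) / (1 - R)"
    using R_less by (simp add: field_simps)
  then have "expected_hitting_time M X b < expected_hitting_time M' X' b"
    unfolding hit hit' using mR by (intro ennreal_lessI) auto
  moreover have "(m - 1) * R = m * R - R" by (simp add: algebra_simps)
  ultimately show ?thesis
    using mR by (simp add: hit hit' flip: m_def)
qed

end
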